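(* Let $\sigma>0$ and $c_1\in\mathbb{R}\setminus\{0\}$. The equation $$u_{t}+\frac{1}{2}\,\frac{\sigma^{2}S^{2}u_{SS}\,u_S^2}{(u_S-c_1Su_{SS})^2}=0$$ for $u=u(S,t)$ admits the four-dimensional Lie algebra $L_4=\langle V_1,V_2,V_3,V_4\rangle$ spanned by $$V_1=S\frac{\partial}{\partial S},\qquad V_2=u\frac{\partial}{\partial u},\qquad V_3=\frac{\partial}{\partial u},\qquad V_4=\frac{\partial}{\partial t};$$ that is, $L_4$ is the Lie algebra of all infinitesimal point symmetries of the equation. The only non-zero commutator relation among the generators (up to antisymmetry) is $[V_2,V_3]=-V_3$. The Lie algebra $L_4$ has the two-dimensional subalgebra $L_2=\langle V_2,V_3\rangle$. The Lie algebra $L_4$ is decomposable and can be represented as the semi-direct sum $L_4=L_2\oplus\langle V_1\rangle\oplus\langle V_4\rangle$.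
   Context: The independent variables are $S>0$ and $t$, the dependent variable is $u$. Let $M$ be the space of points $(S,t,u)$ (with $S>0$) and $M^{(2)}$ the second jet bundle with coordinates $(S,t,u,u_S,u_t,u_{SS},u_{St},u_{tt})$. Write the PDE as $\Delta=0$, where $\Delta$ is its left-hand side regarded as a function on the part of $M^{(2)}$ where $u_S-c_1Su_{SS}\neq0$. For a smooth vector field $V=\xi(S,t,u)\partial_S+\tau(S,t,u)\partial_t+\varphi(S,t,u)\partial_u$ on $M$, $pr^{(2)}V$ denotes its standard second prolongation to $M^{(2)}$. The vector field $V$ is an infinitesimal (point) symmetry of the PDE if $pr^{(2)}V(\Delta)=0$ at all points of $M^{(2)}$ where $\Delta=0$. The set of all infinitesimal symmetries is a Lie algebra, called the Lie algebra admitted by the PDE (its symmetry algebra). A Lie algebra is decomposable if it is the direct sum of two non-zero ideals. A semi-direct sum of subalgebras is a vector-space direct sum in which one of the summands is an ideal (direct sums of ideals are included). *)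

theory Defs
  imports "HOL-Analysis.Analysis" "HOL-Library.Function_Algebras" "HOL-Library.Set_Algebras"
begin

instantiation "fun" :: (type, real_vector) real_vector
begin

definition scaleR_fun_def: "scaleR c f = (\<lambda>x. c *\<^sub>R f x)"

instance
  by standard (simp_all add: scaleR_fun_def fun_eq_iff scaleR_add_right scaleR_add_left)

end

primrec times_cont_differentiable_on ::
  "nat \<Rightarrow> 'a::real_normed_vector set \<Rightarrow> ('a \<Rightarrow> 'b::real_normed_vector) \<Rightarrow> bool" where
  "times_cont_differentiable_on 0 X f \<longleftrightarrow> continuous_on X f"
| "times_cont_differentiable_on (Suc k) X f \<longleftrightarrow>
     (\<forall>x\<in>X. f differentiable (at x)) \<and>
     (\<forall>v. times_cont_differentiable_on k X (\<lambda>x. frechet_derivative f (at x) v))"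

text \<open>Only used for open \<open>X\<close>, since the derivatives are taken with respect to the full
  neighbourhood filter.\<close>

definition smooth_on :: "'a::real_normed_vector set \<Rightarrow> ('a \<Rightarrow> 'b::real_normed_vector) \<Rightarrow> bool"
  where "smooth_on X f \<longleftrightarrow> (\<forall>k. times_cont_differentiable_on k X f)"

text \<open>Points are \<open>(S, t, u)\<close>, first jets \<open>(S, t, u, u\<^sub>S, u\<^sub>t)\<close> and second jets
  \<open>(S, t, u, u\<^sub>S, u\<^sub>t, u\<^sub>S\<^sub>S, u\<^sub>S\<^sub>t, u\<^sub>t\<^sub>t)\<close>.\<close>

type_synonym point = "real \<times> real \<times> real"
type_synonym jet1 = "real \<times> real \<times> real \<times> real \<times> real"
type_synonym jet2 = "real \<times> real \<times> real \<times> real \<times> real \<times> real \<times> real \<times> real"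

definition M :: "point set"
  where "M = {(S, t, u). S > 0}"

text \<open>A vector field \<open>\<xi> \<partial>\<^sub>S + \<tau> \<partial>\<^sub>t + \<phi> \<partial>\<^sub>u\<close> on \<open>M\<close> is the map \<open>(\<xi>, \<tau>, \<phi>)\<close>. The value \<open>0\<close>
  outside of \<open>M\<close> is a normal form which makes equality of vector fields on \<open>M\<close> the equality
  of functions.\<close>

type_synonym vfield = "point \<Rightarrow> point"

definition on_M :: "vfield \<Rightarrow> vfield"
  where "on_M V = (\<lambda>x. if x \<in> M then V x else 0)"

definition vector_fields :: "vfield set"
  where "vector_fields = {V. smooth_on M V \<and> (\<forall>x. x \<notin> M \<longrightarrow> V x = 0)}"

text \<open>The commutator: \<open>[V, W]\<^sup>i = V(W\<^sup>i) - W(V\<^sup>i)\<close>.\<close>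

definition lie_bracket :: "vfield \<Rightarrow> vfield \<Rightarrow> vfield"
  where "lie_bracket V W = on_M (\<lambda>x. frechet_derivative W (at x) (V x) -
                                     frechet_derivative V (at x) (W x))"

definition lie_algebra :: "vfield set \<Rightarrow> bool"
  where "lie_algebra L \<longleftrightarrow> L \<subseteq> vector_fields \<and> subspace L \<and> (\<forall>V\<in>L. \<forall>W\<in>L. lie_bracket V W \<in> L)"

definition lie_subalgebra :: "vfield set \<Rightarrow> vfield set \<Rightarrow> bool"
  where "lie_subalgebra A L \<longleftrightarrow> lie_algebra A \<and> A \<subseteq> L"

definition lie_ideal :: "vfield set \<Rightarrow> vfield set \<Rightarrow> bool"
  where "lie_ideal I L \<longleftrightarrow> I \<subseteq> L \<and> subspace I \<and> (\<forall>V\<in>L. \<forall>W\<in>I. lie_bracket V W \<in> I)"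

text \<open>\<open>L\<close> is the internal direct sum of the subspaces in the list: every element of \<open>L\<close> is a
  sum of one vector from each of them, in a unique way.\<close>

definition direct_sum :: "'a::real_vector set \<Rightarrow> 'a set list \<Rightarrow> bool"
  where "direct_sum L As \<longleftrightarrow> (\<forall>A\<in>set As. subspace A) \<and> bij_betw sum_list (listset As) L"

definition decomposable :: "vfield set \<Rightarrow> bool"
  where "decomposable L \<longleftrightarrow>
    (\<exists>I J. lie_ideal I L \<and> lie_ideal J L \<and> I \<noteq> {0} \<and> J \<noteq> {0} \<and> direct_sum L [I, J])"

definition semidirect_sum :: "vfield set \<Rightarrow> vfield set list \<Rightarrow> bool"
  where "semidirect_sum L As \<longleftrightarrow>
    lie_algebra L \<and> (\<forall>A\<in>set As. lie_subalgebra A L) \<and> direct_sum L As \<and>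
    (\<exists>A\<in>set As. lie_ideal A L)"

text \<open>Total derivatives of functions on \<open>M\<close> (they are functions of first jets) and of
  functions of first jets (they are functions of second jets).\<close>

fun D\<^sub>S :: "(point \<Rightarrow> real) \<Rightarrow> jet1 \<Rightarrow> real" where
  "D\<^sub>S f (S, t, u, us, ut) = frechet_derivative f (at (S, t, u)) (1, 0, us)"

fun D\<^sub>t :: "(point \<Rightarrow> real) \<Rightarrow> jet1 \<Rightarrow> real" where
  "D\<^sub>t f (S, t, u, us, ut) = frechet_derivative f (at (S, t, u)) (0, 1, ut)"

fun D1\<^sub>S :: "(jet1 \<Rightarrow> real) \<Rightarrow> jet2 \<Rightarrow> real" where
  "D1\<^sub>S f (S, t, u, us, ut, uss, ust, utt) =
     frechet_derivative f (at (S, t, u, us, ut)) (1, 0, us, uss, ust)"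

fun D1\<^sub>t :: "(jet1 \<Rightarrow> real) \<Rightarrow> jet2 \<Rightarrow> real" where
  "D1\<^sub>t f (S, t, u, us, ut, uss, ust, utt) =
     frechet_derivative f (at (S, t, u, us, ut)) (0, 1, ut, ust, utt)"

text \<open>The coefficients of the prolongation are given by the recursion
  \<open>\<phi>\<^sup>i = D\<^sub>i \<phi> - u\<^sub>S D\<^sub>i \<xi> - u\<^sub>t D\<^sub>i \<tau>\<close> and
  \<open>\<phi>\<^sup>J\<^sup>i = D\<^sub>i \<phi>\<^sup>J - u\<^sub>J\<^sub>S D\<^sub>i \<xi> - u\<^sub>J\<^sub>t D\<^sub>i \<tau>\<close>.\<close>

definition xi :: "vfield \<Rightarrow> point \<Rightarrow> real" where "xi V x = fst (V x)"
definition tau :: "vfield \<Rightarrow> point \<Rightarrow> real" where "tau V x = fst (snd (V x))"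
definition phi :: "vfield \<Rightarrow> point \<Rightarrow> real" where "phi V x = snd (snd (V x))"

fun phi\<^sub>S :: "vfield \<Rightarrow> jet1 \<Rightarrow> real" where
  "phi\<^sub>S V (S, t, u, us, ut) = (let z = (S, t, u, us, ut) in
     D\<^sub>S (phi V) z - us * D\<^sub>S (xi V) z - ut * D\<^sub>S (tau V) z)"

fun phi\<^sub>t :: "vfield \<Rightarrow> jet1 \<Rightarrow> real" where
  "phi\<^sub>t V (S, t, u, us, ut) = (let z = (S, t, u, us, ut) in
     D\<^sub>t (phi V) z - us * D\<^sub>t (xi V) z - ut * D\<^sub>t (tau V) z)"

fun prolong2 :: "vfield \<Rightarrow> jet2 \<Rightarrow> jet2" where
  "prolong2 V (S, t, u, us, ut, uss, ust, utt) =
    (let x = (S, t, u); y = (S, t, u, us, ut); z = (S, t, u, us, ut, uss, ust, utt) in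
      (xi V x, tau V x, phi V x, phi\<^sub>S V y, phi\<^sub>t V y,
       D1\<^sub>S (phi\<^sub>S V) z - uss * D\<^sub>S (xi V) y - ust * D\<^sub>S (tau V) y,
       D1\<^sub>t (phi\<^sub>S V) z - uss * D\<^sub>t (xi V) y - ust * D\<^sub>t (tau V) y,
       D1\<^sub>t (phi\<^sub>t V) z - ust * D\<^sub>t (xi V) y - utt * D\<^sub>t (tau V) y))"

definition jet_domain :: "real \<Rightarrow> jet2 set"
  where "jet_domain c1 =
    {(S, t, u, us, ut, uss, ust, utt). S > 0 \<and> us - c1 * S * uss \<noteq> 0}"

fun Delta :: "real \<Rightarrow> real \<Rightarrow> jet2 \<Rightarrow> real" where
  "Delta \<sigma> c1 (S, t, u, us, ut, uss, ust, utt) =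
     ut + 1 / 2 * (\<sigma>\<^sup>2 * S\<^sup>2 * uss * us\<^sup>2 / (us - c1 * S * uss)\<^sup>2)"

text \<open>The prolonged field acts on \<open>Delta\<close> by differentiation along it.\<close>

definition infinitesimal_symmetry :: "real \<Rightarrow> real \<Rightarrow> vfield \<Rightarrow> bool"
  where "infinitesimal_symmetry \<sigma> c1 V \<longleftrightarrow> V \<in> vector_fields \<and>
    (\<forall>z\<in>jet_domain c1. Delta \<sigma> c1 z = 0 \<longrightarrow>
       frechet_derivative (Delta \<sigma> c1) (at z) (prolong2 V z) = 0)"

definition symmetry_algebra :: "real \<Rightarrow> real \<Rightarrow> vfield set"
  where "symmetry_algebra \<sigma> c1 = {V. infinitesimal_symmetry \<sigma> c1 V}"

definition V1 :: vfield where "V1 = on_M (\<lambda>(S, t, u). (S, 0, 0))"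
definition V2 :: vfield where "V2 = on_M (\<lambda>(S, t, u). (0, 0, u))"
definition V3 :: vfield where "V3 = on_M (\<lambda>(S, t, u). (0, 0, 1))"
definition V4 :: vfield where "V4 = on_M (\<lambda>(S, t, u). (0, 1, 0))"

definition L4 :: "vfield set" where "L4 = span {V1, V2, V3, V4}"
definition L2 :: "vfield set" where "L2 = span {V2, V3}"

end

theory Submission
  imports Defs
begin

text \<open>The symmetry condition is linear in the coefficients \<open>\<xi>, \<tau>, \<phi>\<close> and their derivatives. Since the
  equation does not involve \<open>u\<^sub>S\<^sub>t\<close>, the coefficient of that coordinate gives \<open>\<tau> = \<tau>(t)\<close>. After
  eliminating \<open>u\<^sub>t\<close> and putting \<open>b = S u\<^sub>S\<^sub>S / u\<^sub>S\<close>, what remains is, up to the factor \<open>(1 - c\<^sub>1 b)\<^sup>3\<close>, a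
  polynomial of degree at most three in \<open>u\<^sub>S\<close> and in \<open>b\<close>. As \<open>c\<^sub>1 \<noteq> 0\<close>, comparing coefficients yields
  \<open>\<xi>\<^sub>u = \<xi>\<^sub>t = \<tau>\<^sub>t = \<phi>\<^sub>S = \<phi>\<^sub>t = \<phi>\<^sub>u\<^sub>u = 0\<close> and \<open>S \<xi>\<^sub>S = \<xi>\<close>, so that \<open>\<xi> = a S\<close>, \<open>\<tau> = d\<close> and
  \<open>\<phi> = b u + c\<close> for constants. The Lie algebra is then computed in the coordinates \<open>(a, b, c, d)\<close>.\<close>

section \<open>Derivatives on the jet spaces\<close>

lemma open_M: "open M"
proof -
  have "M = {x. fst x > 0}" by (auto simp: M_def)
  moreover have "open {x::point. fst x > 0}"
    by (intro open_Collect_less continuous_intros)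
  ultimately show ?thesis by simp
qed

lemma mem_M [simp]: "(S, t, u) \<in> M \<longleftrightarrow> S > 0"
  by (simp add: M_def)

lemma has_derivative_cong_open:
  assumes "open X" "x \<in> X" "\<And>y. y \<in> X \<Longrightarrow> f y = g y"
  shows "(f has_derivative D) (at x) \<longleftrightarrow> (g has_derivative D) (at x)"
  using assms by (metis has_derivative_transform_within_open)

lemma frechet_derivative_cong_open:
  assumes "open X" "x \<in> X" "\<And>y. y \<in> X \<Longrightarrow> f y = g y"
  shows "frechet_derivative f (at x) = frechet_derivative g (at x)"
  unfolding frechet_derivative_def using has_derivative_cong_open[OF assms] by simp

lemma frechet_derivative_at_eq: "(f has_derivative D) (at x) \<Longrightarrow> frechet_derivative f (at x) = D"
  using frechet_derivative_at by metis

text \<open>On an open set, equal functions have equal Frechet derivatives, so the induction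
  hypothesis applies to the directional derivatives. For this \<open>f\<close> and \<open>g\<close>
  must stay arbitrary.\<close>

lemma times_cont_differentiable_on_cong:
  assumes "open X" "\<And>x. x \<in> X \<Longrightarrow> f x = g x" "times_cont_differentiable_on k X g"
  shows "times_cont_differentiable_on k X f"
  using assms(2,3)
proof (induction k arbitrary: f g)
  case 0
  then show ?case by (simp cong: continuous_on_cong)
next
  case (Suc k)
  have "f differentiable (at x)" if "x \<in> X" for x
    using Suc.prems(2) has_derivative_cong_open[OF \<open>open X\<close> that Suc.prems(1)] that
    by (auto simp: differentiable_def)
  moreover have "times_cont_differentiable_on k X (\<lambda>x. frechet_derivative f (at x) v)" for v
    by (rule Suc.IH[of _ "\<lambda>x. frechet_derivative g (at x) v"])
      (use Suc.prems frechet_derivative_cong_open[OF \<open>open X\<close> _ Suc.prems(1)] in auto)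
  ultimately show ?case by simp
qed

section \<open>Smoothness of constant and affine maps\<close>

lemma smooth_on_const: "smooth_on X (\<lambda>x. c)"
proof -
  have "times_cont_differentiable_on k X (\<lambda>x. c)" for k
    by (induction k arbitrary: c) (auto simp: frechet_derivative_const)
  then show ?thesis by (simp add: smooth_on_def)
qed

text \<open>The derivative is \<open>F\<close> at every point, so all directional derivatives are
  constant. Agreement is asked for on \<open>X\<close> only because fields on \<open>M\<close> are
  cut off to \<open>0\<close> outside of \<open>M\<close>.\<close>

lemma smooth_on_affine:
  assumes "open X" "bounded_linear F" "\<And>x. x \<in> X \<Longrightarrow> f x = F x + c"
  shows "smooth_on X f"
proof -
  have d: "((\<lambda>x. F x + c) has_derivative F) (at x)" for x
    using bounded_linear_imp_has_derivative[OF assms(2)] by (auto intro!: derivative_eq_intros)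
  have "times_cont_differentiable_on k X (\<lambda>x. F x + c)" for k
  proof (cases k)
    case 0
    then show ?thesis
      using linear_continuous_on[OF assms(2)] by (simp add: continuous_on_add)
  next
    case (Suc k)
    then show ?thesis
      using d smooth_on_const[of X] unfolding smooth_on_def
      by (auto simp: frechet_derivative_at_eq[OF d] differentiable_def)
  qed
  then show ?thesis
    using times_cont_differentiable_on_cong[OF assms(1,3)] by (simp add: smooth_on_def)
qed

text \<open>This is the part of smoothness that the second prolongation draws on: the function and
  all its directional derivatives are differentiable.\<close>

definition twice_differentiable :: "(point \<Rightarrow> real) \<Rightarrow> bool"
  where "twice_differentiable f \<longleftrightarrow> (\<forall>x\<in>M. f differentiable (at x) \<and>
    (\<forall>v. (\<lambda>y. frechet_derivative f (at y) v) differentiable (at x)))"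

text \<open>A bounded linear map commutes with differentiation. With \<open>l\<close> a coordinate
  projection this covers all three coefficients of a field.\<close>

lemma twice_differentiable_component:
  assumes "V \<in> vector_fields" "bounded_linear l"
  shows "twice_differentiable (\<lambda>x. l (V x))"
proof -
  have "times_cont_differentiable_on (Suc (Suc 0)) M V"
    using assms by (auto simp: vector_fields_def smooth_on_def)
  then have V: "V differentiable (at x)" "(\<lambda>y. frechet_derivative V (at y) v) differentiable (at x)"
    if "x \<in> M" for x v
    using that by (simp, cases v, simp)
  have D: "((\<lambda>x. l (V x)) has_derivative (\<lambda>v. l (frechet_derivative V (at x) v))) (at x)"
    if "x \<in> M" for x
    using bounded_linear.has_derivative[OF assms(2)] V(1)[OF that] frechet_derivative_works by blast
  have "(\<lambda>y. frechet_derivative (\<lambda>x. l (V x)) (at y) v) differentiable (at x)" if x: "x \<in> M" for x v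
  proof -
    obtain G where "((\<lambda>y. frechet_derivative V (at y) v) has_derivative G) (at x)"
      using V(2)[OF x, of v] by (auto simp: differentiable_def)
    then have "((\<lambda>y. l (frechet_derivative V (at y) v)) has_derivative (\<lambda>h. l (G h))) (at x)"
      using bounded_linear.has_derivative[OF assms(2)] by blast
    then show ?thesis
      unfolding differentiable_def
      using has_derivative_cong_open[OF open_M x,
          of "\<lambda>y. frechet_derivative (\<lambda>x. l (V x)) (at y) v" "\<lambda>y. l (frechet_derivative V (at y) v)"]
        frechet_derivative_at_eq[OF D]
      by auto
  qed
  with D show ?thesis by (auto simp: twice_differentiable_def differentiable_def)
qed

lemma twice_differentiable_coeffs:
  assumes "V \<in> vector_fields"
  shows "twice_differentiable (xi V)" "twice_differentiable (tau V)" "twice_differentiable (phi V)"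
  unfolding xi_def tau_def phi_def
  by (rule twice_differentiable_component[OF assms];
      intro bounded_linear_intros bounded_linear_fst bounded_linear_snd
        bounded_linear_fst_comp bounded_linear_snd_comp)+

section \<open>Partial and total derivatives in coordinates\<close>

definition pS :: "(point \<Rightarrow> real) \<Rightarrow> point \<Rightarrow> real"
  where "pS f x = frechet_derivative f (at x) (1, 0, 0)"
definition pt :: "(point \<Rightarrow> real) \<Rightarrow> point \<Rightarrow> real"
  where "pt f x = frechet_derivative f (at x) (0, 1, 0)"
definition pu :: "(point \<Rightarrow> real) \<Rightarrow> point \<Rightarrow> real"
  where "pu f x = frechet_derivative f (at x) (0, 0, 1)"

lemma has_derivative_partials:
  assumes "f differentiable (at x)"
  shows "(f has_derivative (\<lambda>(a, b, c). a * pS f x + b * pt f x + c * pu f x)) (at x)"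
proof -
  have D: "(f has_derivative frechet_derivative f (at x)) (at x)"
    using assms frechet_derivative_works by blast
  then interpret bounded_linear "frechet_derivative f (at x)"
    by (rule has_derivative_bounded_linear)
  have "frechet_derivative f (at x) (a, b, c) = a * pS f x + b * pt f x + c * pu f x" for a b c
  proof -
    have "(a, b, c) = a *\<^sub>R (1, 0, 0) + b *\<^sub>R (0, 1, 0) + c *\<^sub>R (0, 0, 1)" by simp
    then show ?thesis unfolding pS_def pt_def pu_def by (simp only: add scale real_scaleR_def)
  qed
  then have "frechet_derivative f (at x) = (\<lambda>(a, b, c). a * pS f x + b * pt f x + c * pu f x)"
    by (auto simp: fun_eq_iff)
  with D show ?thesis by simp
qed

lemmas frechet_derivative_partials = frechet_derivative_at_eq[OF has_derivative_partials]

lemma twice_differentiableD: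
  assumes "twice_differentiable f" "x \<in> M"
  shows "f differentiable (at x)" "pS f differentiable (at x)" "pt f differentiable (at x)"
    "pu f differentiable (at x)"
  using assms unfolding twice_differentiable_def pS_def pt_def pu_def by blast+

lemma D_partials:
  assumes "twice_differentiable f" "S > 0"
  shows "D\<^sub>S f (S, t, u, p, r) = pS f (S, t, u) + p * pu f (S, t, u)"
    "D\<^sub>t f (S, t, u, p, r) = pt f (S, t, u) + r * pu f (S, t, u)"
  using twice_differentiableD[OF assms(1), of "(S, t, u)"] assms(2)
  by (simp_all add: frechet_derivative_partials)

text \<open>Chain rule for the projection from first jets to points. It lets partial derivatives on
  \<open>M\<close> be differentiated as functions of first jets.\<close>

lemma has_derivative_lift_jet:
  assumes "f differentiable (at (S, t, u))"
  shows "((\<lambda>y::jet1. f (fst y, fst (snd y), fst (snd (snd y)))) has_derivative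
     (\<lambda>(a, b, c, d, e). a * pS f (S, t, u) + b * pt f (S, t, u) + c * pu f (S, t, u)))
     (at (S, t, u, p, r))"
proof -
  have 1: "((\<lambda>y::jet1. (fst y, fst (snd y), fst (snd (snd y)))) has_derivative
    (\<lambda>y. (fst y, fst (snd y), fst (snd (snd y))))) (at (S, t, u, p, r))"
    by (auto intro!: derivative_eq_intros)
  show ?thesis
    using has_derivative_compose[OF 1, of f] has_derivative_partials[OF assms]
    by (fastforce simp: case_prod_unfold)
qed

section \<open>Coefficients of the prolongation\<close>

lemma phi\<^sub>S_partials:
  assumes "V \<in> vector_fields" "S > 0"
  shows "phi\<^sub>S V (S, t, u, p, r) = pS (phi V) (S, t, u) + p * pu (phi V) (S, t, u) -
     p * (pS (xi V) (S, t, u) + p * pu (xi V) (S, t, u)) -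
     r * (pS (tau V) (S, t, u) + p * pu (tau V) (S, t, u))"
  using D_partials twice_differentiable_coeffs assms by (simp add: Let_def del: D\<^sub>S.simps)

lemma phi\<^sub>t_partials:
  assumes "V \<in> vector_fields" "S > 0"
  shows "phi\<^sub>t V (S, t, u, p, r) = pt (phi V) (S, t, u) + r * pu (phi V) (S, t, u) -
     p * (pt (xi V) (S, t, u) + r * pu (xi V) (S, t, u)) -
     r * (pt (tau V) (S, t, u) + r * pu (tau V) (S, t, u))"
  using D_partials twice_differentiable_coeffs assms by (simp add: Let_def del: D\<^sub>t.simps)

text \<open>Here and below \<open>p\<close>, \<open>r\<close>, \<open>q\<close>, \<open>m\<close>,
  \<open>n\<close> stand for \<open>u\<^sub>S\<close>, \<open>u\<^sub>t\<close>,
  \<open>u\<^sub>S\<^sub>S\<close>, \<open>u\<^sub>S\<^sub>t\<close>,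
  \<open>u\<^sub>t\<^sub>t\<close>. The coefficient has the explicit form \<open>?e\<close> on the
  open set of jets with positive \<open>S\<close>, so \<open>?e\<close> may be differentiated
  instead.\<close>

lemma D1\<^sub>S_phi\<^sub>S_partials:
  fixes V :: vfield
  defines "\<xi> \<equiv> xi V" and "\<tau> \<equiv> tau V" and "\<phi> \<equiv> phi V"
  assumes V: "V \<in> vector_fields" and S: "S > 0" and x: "x = (S, t, u)"
  shows "D1\<^sub>S (phi\<^sub>S V) (S, t, u, p, r, q, m, n) =
     pS (pS \<phi>) x + p * pu (pS \<phi>) x + q * pu \<phi> x + p * (pS (pu \<phi>) x + p * pu (pu \<phi>) x) -
     q * (pS \<xi> x + p * pu \<xi> x) -
     p * (pS (pS \<xi>) x + p * pu (pS \<xi>) x + q * pu \<xi> x + p * (pS (pu \<xi>) x + p * pu (pu \<xi>) x)) -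
     m * (pS \<tau> x + p * pu \<tau> x) -
     r * (pS (pS \<tau>) x + p * pu (pS \<tau>) x + q * pu \<tau> x + p * (pS (pu \<tau>) x + p * pu (pu \<tau>) x))"
proof -
  let ?\<pi> = "\<lambda>y::jet1. (fst y, fst (snd y), fst (snd (snd y)))"
  let ?p = "\<lambda>y::jet1. fst (snd (snd (snd y)))"
  let ?r = "\<lambda>y::jet1. snd (snd (snd (snd y)))"
  let ?e = "\<lambda>y. pS \<phi> (?\<pi> y) + ?p y * pu \<phi> (?\<pi> y) -
     ?p y * (pS \<xi> (?\<pi> y) + ?p y * pu \<xi> (?\<pi> y)) -
     ?r y * (pS \<tau> (?\<pi> y) + ?p y * pu \<tau> (?\<pi> y))"
  let ?y = "(S, t, u, p, r)"
  have xM: "(S, t, u) \<in> M" using S by simp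
  note dd = twice_differentiable_coeffs[OF V, folded \<xi>_def \<tau>_def \<phi>_def]
  note df = dd[THEN twice_differentiableD(2), OF xM] dd[THEN twice_differentiableD(4), OF xM]
  note L = df[THEN has_derivative_lift_jet, of p r]
  have J: "open {y::jet1. fst y > 0}" "?y \<in> {y::jet1. fst y > 0}"
    using S by (auto intro!: open_Collect_less continuous_intros)
  have eq: "phi\<^sub>S V y = ?e y" if "y \<in> {y. fst y > 0}" for y
    using that phi\<^sub>S_partials[OF V] by (cases y) (simp add: \<xi>_def \<tau>_def \<phi>_def del: phi\<^sub>S.simps)
  have p: "(?p has_derivative ?p) (at ?y)" and r: "(?r has_derivative ?r) (at ?y)"
    by (auto intro!: derivative_eq_intros)
  \<comment> \<open>The rules are nested exactly as \<open>?e\<close> is built. \<open>L(1)\<close>,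
    \<open>L(2)\<close>, \<open>L(3)\<close> belong to the \<open>S\<close>-partials of \<xi>,
    \<tau>, \<phi>, and \<open>L(4)\<close>, \<open>L(5)\<close>, \<open>L(6)\<close> to their
    \<open>u\<close>-partials.\<close>
  note D = has_derivative_diff[OF has_derivative_diff[OF
    has_derivative_add[OF L(3) has_derivative_mult[OF p L(6)]]
    has_derivative_mult[OF p has_derivative_add[OF L(1) has_derivative_mult[OF p L(4)]]]]
    has_derivative_mult[OF r has_derivative_add[OF L(2) has_derivative_mult[OF p L(5)]]]]
  have "D1\<^sub>S (phi\<^sub>S V) (S, t, u, p, r, q, m, n) = frechet_derivative ?e (at ?y) (1, 0, p, q, m)"
    unfolding D1\<^sub>S.simps by (rule fun_cong, rule frechet_derivative_cong_open[OF J], rule eq)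
  then show ?thesis
    unfolding frechet_derivative_at_eq[OF D] by (simp add: x algebra_simps)
qed

lemma Delta_has_derivative:
  assumes "p - c * S * q \<noteq> 0"
  shows "(Delta \<sigma> c has_derivative (\<lambda>(dS, dt, du, dp, dr, dq, dm, dn). dr + \<sigma>\<^sup>2 / 2 *
     (2 * S * q * p ^ 3 * dS - 2 * c * S ^ 3 * q\<^sup>2 * p * dp + S\<^sup>2 * p\<^sup>2 * (p + c * S * q) * dq) /
       (p - c * S * q) ^ 3)) (at (S, t, u, p, r, q, m, n))"
proof -
  let ?p = "\<lambda>z::jet2. fst (snd (snd (snd z)))"
  let ?q = "\<lambda>z::jet2. fst (snd (snd (snd (snd (snd z)))))"
  let ?r = "\<lambda>z::jet2. fst (snd (snd (snd (snd z))))"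
  have eq: "Delta \<sigma> c = (\<lambda>z. ?r z + 1 / 2 * (\<sigma>\<^sup>2 * (fst z)\<^sup>2 * ?q z * (?p z)\<^sup>2 /
      (?p z - c * fst z * ?q z)\<^sup>2))"
    by (auto simp: fun_eq_iff)
  let ?z = "(S, t, u, p, r, q, m, n)"
  let ?d = "p - c * S * q"
  have N: "((\<lambda>z. \<sigma>\<^sup>2 * (fst z)\<^sup>2 * ?q z * (?p z)\<^sup>2) has_derivative (\<lambda>h. \<sigma>\<^sup>2 *
      (2 * S * fst h * q * p\<^sup>2 + S\<^sup>2 * ?q h * p\<^sup>2 + 2 * S\<^sup>2 * q * p * ?p h))) (at ?z)"
    by (auto intro!: derivative_eq_intros simp: fun_eq_iff algebra_simps power2_eq_square)
  have D: "((\<lambda>z. (?p z - c * fst z * ?q z)\<^sup>2) has_derivative (\<lambda>h.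
      2 * ?d * (?p h - c * fst h * q - c * S * ?q h))) (at ?z)"
    by (auto intro!: derivative_eq_intros simp: fun_eq_iff algebra_simps power2_eq_square)
  have r: "(?r has_derivative ?r) (at ?z)"
    by (auto intro!: derivative_eq_intros)
  have nz: "(\<lambda>z. (?p z - c * fst z * ?q z)\<^sup>2) ?z \<noteq> 0" using assms by simp
  note E = has_derivative_add[OF r has_derivative_mult_right[OF has_derivative_divide'[OF N D nz], of "1/2"]]
  \<comment> \<open>The numerator from the quotient rule contains one factor \<open>?d\<close>,
    which reduces the fourth power in the denominator to the cube.\<close>
  have frac: "1 / 2 * (\<sigma>\<^sup>2 * (2 * S * dS * q * p\<^sup>2 + S\<^sup>2 * dq * p\<^sup>2 + 2 * S\<^sup>2 * q * p * dp) * ?d\<^sup>2 -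
      \<sigma>\<^sup>2 * S\<^sup>2 * q * p\<^sup>2 * (2 * ?d * (dp - c * dS * q - c * S * dq))) / (?d\<^sup>2 * ?d\<^sup>2) =
     \<sigma>\<^sup>2 / 2 * (2 * S * q * p ^ 3 * dS - 2 * c * S ^ 3 * q\<^sup>2 * p * dp + S\<^sup>2 * p\<^sup>2 * (p + c * S * q) * dq) /
       ?d ^ 3" (is "1 / 2 * ?A / _ = _ / 2 * ?B / _") for dS dp dq
  proof -
    have "?A = ?d * (\<sigma>\<^sup>2 * ?B)" by algebra
    moreover have "1 / 2 * (e * (s * b)) / (e\<^sup>2 * e\<^sup>2) = s / 2 * b / e ^ 3" if "e \<noteq> 0" for e b s :: real
      using that by (simp add: power2_eq_square power3_eq_cube)
    ultimately show ?thesis using assms by (simp only:) simp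
  qed
  show ?thesis
    unfolding eq
    by (rule has_derivative_eq_rhs[OF E], rule ext, clarify)
      (simp only: fst_conv snd_conv split_conv frac times_divide_eq_right)
qed

section \<open>The symmetry condition\<close>

text \<open>Agreement on \<open>M\<close> suffices because \<open>M\<close> is open.\<close>

lemma partials_affine:
  assumes "\<And>S t u. S > 0 \<Longrightarrow> f (S, t, u) = \<alpha> * S + \<beta> * t + \<gamma> * u + \<delta>" "x \<in> M"
  shows "pS f x = \<alpha>" "pt f x = \<beta>" "pu f x = \<gamma>"
proof -
  let ?g = "\<lambda>x::point. \<alpha> * fst x + \<beta> * fst (snd x) + \<gamma> * snd (snd x) + \<delta>"
  have "(?g has_derivative (\<lambda>x. \<alpha> * fst x + \<beta> * fst (snd x) + \<gamma> * snd (snd x))) (at x)"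
    by (auto intro!: derivative_eq_intros)
  moreover have "f y = ?g y" if "y \<in> M" for y
    using assms(1) that by (cases y) simp
  ultimately have "(f has_derivative (\<lambda>x. \<alpha> * fst x + \<beta> * fst (snd x) + \<gamma> * snd (snd x))) (at x)"
    using has_derivative_cong_open[OF open_M assms(2), of f ?g] by simp
  then show "pS f x = \<alpha>" "pt f x = \<beta>" "pu f x = \<gamma>"
    by (simp_all add: pS_def pt_def pu_def frechet_derivative_at_eq)
qed

lemma partials_constant:
  assumes "\<And>y. y \<in> M \<Longrightarrow> f y = \<delta>" "x \<in> M"
  shows "pS f x = 0" "pt f x = 0" "pu f x = 0"
  using partials_affine[of f 0 0 0 \<delta> x] assms by simp_all

text \<open>The coefficient of the prolonged field along \<open>u\<^sub>S\<^sub>S\<close>, the only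
  second-order coordinate on which \<open>Delta\<close> depends.\<close>

definition prolonged_SS :: "vfield \<Rightarrow> jet2 \<Rightarrow> real"
  where "prolonged_SS V z = fst (snd (snd (snd (snd (snd (prolong2 V z))))))"

text \<open>The mixed second partials enter only through the sum of their two orders, and are kept
  as such sums.\<close>

lemma prolonged_SS_eq:
  fixes V :: vfield
  defines "\<xi> \<equiv> xi V" and "\<tau> \<equiv> tau V" and "\<phi> \<equiv> phi V"
  assumes "V \<in> vector_fields" "S > 0" "x = (S, t, u)"
  shows "prolonged_SS V (S, t, u, p, r, q, m, n) =
     pS (pS \<phi>) x + p * (pu (pS \<phi>) x + pS (pu \<phi>) x) + p\<^sup>2 * pu (pu \<phi>) x + q * pu \<phi> x -
     p * pS (pS \<xi>) x - p\<^sup>2 * (pu (pS \<xi>) x + pS (pu \<xi>) x) - p ^ 3 * pu (pu \<xi>) x -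
     q * (2 * pS \<xi> x + 3 * p * pu \<xi> x) - 2 * m * (pS \<tau> x + p * pu \<tau> x) -
     r * (pS (pS \<tau>) x + p * (pu (pS \<tau>) x + pS (pu \<tau>) x) + p\<^sup>2 * pu (pu \<tau>) x + q * pu \<tau> x)"
proof -
  note coeffs = twice_differentiable_coeffs[OF assms(4)]
  show ?thesis
    using D1\<^sub>S_phi\<^sub>S_partials[OF assms(4,5) refl, of t u p r q m n]
      D_partials(1)[OF coeffs(1) assms(5)] D_partials(1)[OF coeffs(2) assms(5)]
    by (simp add: prolonged_SS_def Let_def assms(6) \<xi>_def \<tau>_def \<phi>_def
        power2_eq_square power3_eq_cube algebra_simps del: D\<^sub>S.simps D\<^sub>t.simps D1\<^sub>S.simps D1\<^sub>t.simps)
qed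

lemma prolonged_Delta:
  fixes V :: vfield
  assumes "p - c * S * q \<noteq> 0"
  shows "frechet_derivative (Delta \<sigma> c) (at (S, t, u, p, r, q, m, n))
      (prolong2 V (S, t, u, p, r, q, m, n)) =
    phi\<^sub>t V (S, t, u, p, r) + \<sigma>\<^sup>2 / 2 *
     (2 * S * q * p ^ 3 * xi V (S, t, u) - 2 * c * S ^ 3 * q\<^sup>2 * p * phi\<^sub>S V (S, t, u, p, r) +
       S\<^sup>2 * p\<^sup>2 * (p + c * S * q) * prolonged_SS V (S, t, u, p, r, q, m, n)) / (p - c * S * q) ^ 3"
  unfolding frechet_derivative_at_eq[OF Delta_has_derivative[OF assms]]
  by (simp add: Let_def prolonged_SS_def del: phi\<^sub>S.simps phi\<^sub>t.simps D\<^sub>S.simps D\<^sub>t.simps D1\<^sub>S.simps D1\<^sub>t.simps)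

text \<open>On the solution jets with \<open>u\<^sub>S \<noteq> 0\<close> the coordinate \<open>b = S u\<^sub>S\<^sub>S / u\<^sub>S\<close> turns the symmetry
  condition into a polynomial identity in \<open>u\<^sub>S\<close> and \<open>b\<close>.\<close>

lemma symmetry_condition:
  fixes \<sigma> c S b p :: real
  defines "r \<equiv> - (\<sigma>\<^sup>2 / 2) * S * b * p / (1 - c * b)\<^sup>2"
  assumes V: "infinitesimal_symmetry \<sigma> c V" and S: "S > 0" and p: "p \<noteq> 0" and b: "1 - c * b \<noteq> 0"
  shows "(1 - c * b) ^ 3 * phi\<^sub>t V (S, t, u, p, r) + \<sigma>\<^sup>2 / 2 *
     (2 * b * p * xi V (S, t, u) - 2 * c * S * b\<^sup>2 * phi\<^sub>S V (S, t, u, p, r) +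
       S\<^sup>2 * (1 + c * b) * prolonged_SS V (S, t, u, p, r, b * p / S, m, 0)) = 0"
proof -
  let ?q = "b * p / S"
  \<comment> \<open>\<open>r\<close> is the value of \<open>u\<^sub>t\<close> that solves
    \<open>Delta = 0\<close>. The coordinate \<open>u\<^sub>S\<^sub>t = m\<close> stays free, and
    \<open>u\<^sub>t\<^sub>t\<close> is set to 0 since it does not occur in
    \<open>Delta\<close>.\<close>
  let ?z = "(S, t, u, p, r, ?q, m, 0)"
  have d: "p - c * S * ?q = p * (1 - c * b)" using S by (simp add: algebra_simps)
  then have dnz: "p - c * S * ?q \<noteq> 0" using p b by simp
  then have "?z \<in> jet_domain c" using S by (simp add: jet_domain_def)
  moreover have "Delta \<sigma> c ?z = 0"
  proof -
    have "\<sigma>\<^sup>2 * S\<^sup>2 * ?q * p\<^sup>2 = \<sigma>\<^sup>2 * S * b * p * p\<^sup>2"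
      using S by (simp add: power2_eq_square)
    then show ?thesis
      unfolding Delta.simps d r_def power_mult_distrib using p by simp
  qed
  ultimately have "frechet_derivative (Delta \<sigma> c) (at ?z) (prolong2 V ?z) = 0"
    using V unfolding infinitesimal_symmetry_def by blast
  then have eq: "phi\<^sub>t V (S, t, u, p, r) + \<sigma>\<^sup>2 / 2 *
     (2 * S * ?q * p ^ 3 * xi V (S, t, u) - 2 * c * S ^ 3 * ?q\<^sup>2 * p * phi\<^sub>S V (S, t, u, p, r) +
       S\<^sup>2 * p\<^sup>2 * (p + c * S * ?q) * prolonged_SS V ?z) / (p * (1 - c * b)) ^ 3 = 0"
    unfolding prolonged_Delta[OF dnz] d .
  \<comment> \<open>In terms of \<open>b\<close> the numerator splits off \<open>p ^ 3\<close>,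
    which cancels against the denominator \<open>(p * (1 - c * b)) ^ 3\<close>.\<close>
  have num: "2 * S * ?q * p ^ 3 * X - 2 * c * S ^ 3 * ?q\<^sup>2 * p * Y + S\<^sup>2 * p\<^sup>2 * (p + c * S * ?q) * Z =
    p ^ 3 * (2 * b * p * X - 2 * c * S * b\<^sup>2 * Y + S\<^sup>2 * (1 + c * b) * Z)" for X Y Z
    using S by (simp add: field_simps power2_eq_square power3_eq_cube)
  have "e ^ 3 * F + k * N = 0" if "F + k * (p ^ 3 * N) / (p * e) ^ 3 = 0" "e \<noteq> 0" for e F k N
    using that p by (simp add: power_mult_distrib field_simps)
  from this[OF eq[unfolded num] b] show ?thesis .
qed

text \<open>A polynomial with infinitely many roots is zero. The exceptional point \<open>e\<close>
  allows for the excluded values \<open>p = 0\<close> and \<open>b = 1 / c\<close>.\<close>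

lemma cubic_coeffs_eq_0:
  fixes a0 a1 a2 a3 e :: real
  assumes "\<And>x. x \<noteq> e \<Longrightarrow> a0 + a1 * x + a2 * x\<^sup>2 + a3 * x ^ 3 = 0"
  shows "a0 = 0" "a1 = 0" "a2 = 0" "a3 = 0"
proof -
  let ?P = "[:a0, a1, a2, a3:]"
  have "UNIV - {e} \<subseteq> {x. poly ?P x = 0}"
    using assms by (auto simp: algebra_simps power2_eq_square power3_eq_cube)
  moreover have "infinite (UNIV - {e})"
    by (simp add: infinite_UNIV_char_0)
  ultimately have "?P = 0"
    using poly_roots_finite finite_subset by blast
  then show "a0 = 0" "a1 = 0" "a2 = 0" "a3 = 0" by simp_all
qed

text \<open>Pure algebra at one point: \<open>X\<close>, \<open>T\<close>, \<open>F\<close> refer to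
  \<xi>, \<tau>, \<phi>, the suffixes to partial derivatives, and \<open>Fm\<close>,
  \<open>Xm\<close> to the sums of the two mixed partials. Coefficients are compared first in
  \<open>p\<close>, then in \<open>b\<close>.\<close>

lemma determining_equations:
  fixes c k S :: real
  assumes "S > 0" "k > 0" "c \<noteq> 0"
    and eq: "\<And>p b. p \<noteq> 0 \<Longrightarrow> 1 - c * b \<noteq> 0 \<Longrightarrow>
      (1 - c * b) ^ 3 * (Ft - p * Xt) - k * S * b * p * (1 - c * b) * (Fu - p * Xu - Tt) +
      k * (2 * b * p * X - 2 * c * S * b\<^sup>2 * (Fs + p * (Fu - Xs) - p\<^sup>2 * Xu) +
        S\<^sup>2 * (1 + c * b) * (Fss + p * (Fm - Xss) + p\<^sup>2 * (Fuu - Xm) - p ^ 3 * Xuu) +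
        S * (1 + c * b) * b * p * (Fu - 2 * Xs - 3 * p * Xu)) = 0"
  shows "Xu = 0" "Xt = 0" "Tt = 0" "X = S * Xs" "Fs = 0" "Ft = 0" "Fuu = Xm"
proof -
  define P0 where "P0 b = (1 - c * b) ^ 3 * Ft + k * (S\<^sup>2 * (1 + c * b) * Fss - 2 * c * S * b\<^sup>2 * Fs)" for b
  define P1 where "P1 b = - ((1 - c * b) ^ 3 * Xt) - k * S * b * (1 - c * b) * (Fu - Tt) +
    k * (2 * b * X - 2 * c * S * b\<^sup>2 * (Fu - Xs) + S\<^sup>2 * (1 + c * b) * (Fm - Xss) +
      S * (1 + c * b) * b * (Fu - 2 * Xs))" for b
  \<comment> \<open>The three contributions of \<open>Xu\<close> to the coefficient of
    \<open>p\<^sup>2\<close> combine to a multiple of \<open>1 + c * b\<close>.\<close>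
  define P2 where "P2 b = k * S * (1 + c * b) * (S * (Fuu - Xm) - 2 * b * Xu)" for b
  have P: "P0 b = 0" "P1 b = 0" "P2 b = 0" if "b \<noteq> 1 / c" for b
  proof -
    have e: "1 - c * b \<noteq> 0" using that \<open>c \<noteq> 0\<close> by (auto simp: field_simps)
    have "P0 b + P1 b * p + P2 b * p\<^sup>2 + (- k * S\<^sup>2 * (1 + c * b) * Xuu) * p ^ 3 = 0" if "p \<noteq> 0" for p
      using eq[OF that e] unfolding P0_def P1_def P2_def by algebra
    from cubic_coeffs_eq_0[OF this] show "P0 b = 0" "P1 b = 0" "P2 b = 0" by blast+
  qed
  have "(Ft + k * S\<^sup>2 * Fss) + (- 3 * c * Ft + k * S\<^sup>2 * c * Fss) * b +
      (3 * c\<^sup>2 * Ft - 2 * k * c * S * Fs) * b\<^sup>2 + (- (c ^ 3) * Ft) * b ^ 3 = 0" if "b \<noteq> 1 / c" for b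
    using P(1)[OF that] unfolding P0_def by algebra
  \<comment> \<open>The cubic coefficient gives \<open>Ft = 0\<close> because \<open>c\<close> is
    non-zero; then the quadratic one gives \<open>Fs = 0\<close>.\<close>
  from cubic_coeffs_eq_0[OF this] show "Ft = 0" "Fs = 0" using assms by auto
  have "k * S * S * (Fuu - Xm) + k * S * (c * S * (Fuu - Xm) - 2 * Xu) * b +
      (- 2 * k * S * c * Xu) * b\<^sup>2 + 0 * b ^ 3 = 0" if "b \<noteq> 1 / c" for b
    using P(3)[OF that] unfolding P2_def by algebra
  from cubic_coeffs_eq_0[OF this] show "Xu = 0" "Fuu = Xm" using assms by auto
  have "(k * S\<^sup>2 * (Fm - Xss) - Xt) +
      (3 * c * Xt + k * (S * Tt + 2 * X - 2 * S * Xs + S\<^sup>2 * c * (Fm - Xss))) * b +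
      (- 3 * c\<^sup>2 * Xt - k * c * S * Tt) * b\<^sup>2 + (c ^ 3 * Xt) * b ^ 3 = 0" if "b \<noteq> 1 / c" for b
    using P(2)[OF that] unfolding P1_def by algebra
  \<comment> \<open>Read from the top degree down: cubic for \<open>Xt\<close>, quadratic for
    \<open>Tt\<close>, constant for \<open>Fm = Xss\<close>, and finally linear for
    \<open>X = S * Xs\<close>.\<close>
  note Q = cubic_coeffs_eq_0[OF this]
  show Xt: "Xt = 0" using Q(4) assms by simp
  show Tt: "Tt = 0" using Q(3) Xt assms by simp
  have "Fm - Xss = 0" using Q(1) Xt assms by simp
  then show "X = S * Xs" using Q(2) Xt Tt assms by simp
qed

section \<open>Integration of the determining equations\<close>

text \<open>Mean value theorem along the segment. Only the derivative in the direction
  \<open>y - x\<close> has to vanish.\<close>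

lemma eq_if_derivative_0_on_segment:
  fixes f :: "'a::real_normed_vector \<Rightarrow> real"
  assumes "\<And>z. z \<in> closed_segment x y \<Longrightarrow> \<exists>D. (f has_derivative D) (at z) \<and> D (y - x) = 0"
  shows "f x = f y"
proof -
  let ?l = "\<lambda>s. x + s *\<^sub>R (y - x)"
  have l: "(?l has_derivative (\<lambda>h. h *\<^sub>R (y - x))) (at s within {0..1})" for s
    by (auto intro!: derivative_eq_intros)
  have "\<exists>D. (f has_derivative D) (at (?l s)) \<and> D (y - x) = 0" if "s \<in> {0..1}" for s
    by (rule assms) (use that in \<open>auto simp: in_segment algebra_simps intro!: exI[of _ s]\<close>)
  then obtain D where D: "(f has_derivative D s) (at (?l s))" "D s (y - x) = 0" if "s \<in> {0..1}" for s
    by metis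
  have "((\<lambda>s. f (?l s)) has_derivative (\<lambda>h. D s (h *\<^sub>R (y - x)))) (at s within {0..1})"
    if "0 \<le> s" "s \<le> 1" for s
    using has_derivative_compose[OF l D(1)] that by auto
  from mvt_very_simple[OF zero_le_one this] obtain s where
    s: "s \<in> {0..1}" "f (?l 1) - f (?l 0) = D s ((1 - 0) *\<^sub>R (y - x))" by blast
  then show ?thesis using D(2)[OF s(1)] by simp
qed

lemma convex_M: "convex M"
proof -
  have "M = {0<..} \<times> UNIV" by (auto simp: M_def)
  moreover have "convex ({0<..} \<times> UNIV :: point set)"
    by (intro convex_Times) simp_all
  ultimately show ?thesis by simp
qed

lemma eq_if_derivative_0_on_M:
  assumes "x \<in> M" "y \<in> M" "\<And>z. z \<in> M \<Longrightarrow> \<exists>D. (f has_derivative D) (at z) \<and> D (y - x) = (0::real)"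
  shows "f x = f y"
  using eq_if_derivative_0_on_segment[of x y f] assms closed_segment_subset[OF assms(1,2) convex_M]
  by blast

section \<open>The affine fields and their symmetry property\<close>

text \<open>The field \<open>a V1 + b V2 + c V3 + d V4\<close>, so that the four parameters are
  coordinates on \<open>L4\<close>.\<close>

definition affine_field :: "real \<Rightarrow> real \<Rightarrow> real \<Rightarrow> real \<Rightarrow> vfield"
  where "affine_field a b c d = on_M (\<lambda>(S, t, u). (a * S, d, b * u + c))"

lemma affine_field_on_M:
  "S > 0 \<Longrightarrow> affine_field a b c d (S, t, u) = (a * S, d, b * u + c)"
  by (simp add: affine_field_def on_M_def)

lemma affine_field_in_vector_fields: "affine_field a b c d \<in> vector_fields"
proof -
  let ?F = "\<lambda>x::point. (a * fst x, 0, b * snd (snd x))"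
  have "?F = (\<lambda>x. (a *\<^sub>R fst x, 0, b *\<^sub>R snd (snd x)))" by simp
  moreover have "bounded_linear \<dots>"
    by (intro bounded_linear_Pair bounded_linear_const_scaleR bounded_linear_fst bounded_linear_snd
        bounded_linear_zero bounded_linear_snd_comp)
  ultimately have "bounded_linear ?F" by simp
  then have "smooth_on M (affine_field a b c d)"
    by (rule smooth_on_affine[OF open_M, where c = "(0, d, c)"]) (auto simp: affine_field_def on_M_def)
  then show ?thesis by (auto simp: vector_fields_def affine_field_def on_M_def)
qed

text \<open>The equation is invariant under translations of \<open>t\<close> and \<open>u\<close>,
  and \<open>Delta\<close> is homogeneous of degree 0 under scaling of \<open>S\<close> and, with
  \<open>u\<^sub>t\<close> scaled along, of degree 1 under scaling of \<open>u\<close>. Hence the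
  prolonged field maps \<open>Delta\<close> to \<open>b * Delta\<close>.\<close>

lemma affine_field_symmetry:
  "infinitesimal_symmetry \<sigma> c1 (affine_field a b c d)"
proof -
  let ?V = "affine_field a b c d"
  have coeffs: "xi ?V (S, t, u) = a * S + 0 * t + 0 * u + 0"
    "tau ?V (S, t, u) = 0 * S + 0 * t + 0 * u + d"
    "phi ?V (S, t, u) = 0 * S + 0 * t + b * u + c" if "S > 0" for S t u
    using that by (simp_all add: xi_def tau_def phi_def affine_field_on_M)
  have first: "pS (xi ?V) x = a" "pt (xi ?V) x = 0" "pu (xi ?V) x = 0"
    "pS (tau ?V) x = 0" "pt (tau ?V) x = 0" "pu (tau ?V) x = 0"
    "pS (phi ?V) x = 0" "pt (phi ?V) x = 0" "pu (phi ?V) x = b" if "x \<in> M" for x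
    using partials_affine[of "xi ?V", OF coeffs(1) that] partials_affine[of "tau ?V", OF coeffs(2) that]
      partials_affine[of "phi ?V", OF coeffs(3) that] by simp_all
  have second: "pS (pS f) x = 0" "pu (pS f) x = 0" "pS (pu f) x = 0" "pu (pu f) x = 0"
    if "x \<in> M" "f \<in> {xi ?V, tau ?V, phi ?V}" for x f
    using that first partials_constant[of "pS f" _ x] partials_constant[of "pu f" _ x] by auto
  have "frechet_derivative (Delta \<sigma> c1) (at z) (prolong2 ?V z) = 0"
    if z: "z \<in> jet_domain c1" "Delta \<sigma> c1 z = 0" for z
  proof -
    obtain S t u p r q m n where zz: "z = (S, t, u, p, r, q, m, n)" by (metis prod.exhaust)
    have S: "S > 0" and e: "p - c1 * S * q \<noteq> 0" using z(1) by (auto simp: jet_domain_def zz)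
    have M: "(S, t, u) \<in> M" using S by simp
    have phi_S: "phi\<^sub>S ?V (S, t, u, p, r) = (b - a) * p"
      unfolding phi\<^sub>S_partials[OF affine_field_in_vector_fields S] first[OF M]
      by (simp add: algebra_simps)
    have phi_t: "phi\<^sub>t ?V (S, t, u, p, r) = b * r"
      unfolding phi\<^sub>t_partials[OF affine_field_in_vector_fields S] first[OF M]
      by (simp add: algebra_simps)
    have SS: "prolonged_SS ?V (S, t, u, p, r, q, m, n) = (b - 2 * a) * q"
      unfolding prolonged_SS_eq[OF affine_field_in_vector_fields S refl]
      by (simp add: first[OF M] second[OF M] algebra_simps)
    have "r = - (\<sigma>\<^sup>2 / 2) * (S\<^sup>2 * q * p\<^sup>2) / (p - c1 * S * q)\<^sup>2"
      using z(2) by (simp add: zz)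
    then have r: "b * r = - (\<sigma>\<^sup>2 / 2) * (b * (S\<^sup>2 * q * p\<^sup>2) / (p - c1 * S * q)\<^sup>2)"
      by simp
    have xi: "xi ?V (S, t, u) = a * S" using coeffs(1) S by simp
    have "frechet_derivative (Delta \<sigma> c1) (at z) (prolong2 ?V z) =
       \<sigma>\<^sup>2 / 2 * ((2 * S * q * p ^ 3 * (a * S) - 2 * c1 * S ^ 3 * q\<^sup>2 * p * ((b - a) * p) +
       S\<^sup>2 * p\<^sup>2 * (p + c1 * S * q) * ((b - 2 * a) * q)) / (p - c1 * S * q) ^ 3 -
       b * (S\<^sup>2 * q * p\<^sup>2) / (p - c1 * S * q)\<^sup>2)"
      unfolding zz prolonged_Delta[OF e] phi_S phi_t SS xi r by (simp add: right_diff_distrib)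
    \<comment> \<open>The terms with \<open>a\<close> cancel, and the rest contains the factor
      needed to reduce the cube to a square.\<close>
    also have "2 * S * q * p ^ 3 * (a * S) - 2 * c1 * S ^ 3 * q\<^sup>2 * p * ((b - a) * p) +
       S\<^sup>2 * p\<^sup>2 * (p + c1 * S * q) * ((b - 2 * a) * q) = (p - c1 * S * q) * (b * (S\<^sup>2 * q * p\<^sup>2))"
      by algebra
    also have "\<dots> / (p - c1 * S * q) ^ 3 = b * (S\<^sup>2 * q * p\<^sup>2) / (p - c1 * S * q)\<^sup>2"
      using e by (simp add: power2_eq_square power3_eq_cube)
    finally show ?thesis by simp
  qed
  then show ?thesis
    using affine_field_in_vector_fields by (simp add: infinitesimal_symmetry_def)
qed

section \<open>The coefficients of an arbitrary symmetry\<close>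

context
  fixes \<sigma> c1 :: real and V :: vfield
  assumes \<sigma>: "\<sigma> > 0" and c1: "c1 \<noteq> 0" and sym: "infinitesimal_symmetry \<sigma> c1 V"
begin

lemma symmetry_in_vector_fields: "V \<in> vector_fields"
  using sym by (simp add: infinitesimal_symmetry_def)

lemmas symmetry_coeffs = twice_differentiable_coeffs[OF symmetry_in_vector_fields]

text \<open>The mixed derivative \<open>u\<^sub>S\<^sub>t\<close> is free on the solution jets, so its coefficient vanishes.\<close>

lemma symmetry_tau:
  assumes "x \<in> M"
  shows "pS (tau V) x = 0" "pu (tau V) x = 0"
proof -
  obtain S t u where x: "x = (S, t, u)" by (cases x)
  then have S: "S > 0" using assms by simp
  have "pS (tau V) x + p * pu (tau V) x = 0" if "p \<noteq> 0" for p
  proof -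
    \<comment> \<open>With \<open>b = 0\<close> both \<open>u\<^sub>t\<close> and
      \<open>u\<^sub>S\<^sub>S\<close> vanish. The conditions for \<open>m = 0\<close> and
      \<open>m = 1\<close> then differ only in the term with \<open>m\<close>.\<close>
    have "S\<^sup>2 * \<sigma>\<^sup>2 * (pS (tau V) x + p * pu (tau V) x) = 0"
      using symmetry_condition[OF sym S that, of 0 t u 0] symmetry_condition[OF sym S that, of 0 t u 1]
      unfolding prolonged_SS_eq[OF symmetry_in_vector_fields S refl]
      by (simp add: x algebra_simps del: phi\<^sub>S.simps phi\<^sub>t.simps)
    then show ?thesis using S \<sigma> by simp
  qed
  from this[of 1] this[of 2] show "pS (tau V) x = 0" "pu (tau V) x = 0" by simp_all
qed

lemma symmetry_determining_equations:
  assumes S: "S > 0" and x: "x = (S, t, u)"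
  shows "pu (xi V) x = 0" "pt (xi V) x = 0" "pt (tau V) x = 0" "xi V x = S * pS (xi V) x"
    "pS (phi V) x = 0" "pt (phi V) x = 0" "pu (pu (phi V)) x = pu (pS (xi V)) x + pS (pu (xi V)) x"
proof -
  have M: "x \<in> M" using assms by simp
  \<comment> \<open>The first partials vanish on the whole open set \<open>M\<close>, hence so do
    their own partials.\<close>
  have tau2: "pS (pS (tau V)) x = 0" "pu (pS (tau V)) x = 0" "pS (pu (tau V)) x = 0"
    "pu (pu (tau V)) x = 0" "pS (tau V) x = 0" "pu (tau V) x = 0"
    using partials_constant[of "pS (tau V)" 0 x] partials_constant[of "pu (tau V)" 0 x] symmetry_tau M
    by simp_all
  have k: "\<sigma>\<^sup>2 / 2 > 0" using \<sigma> by simp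
  let ?k = "\<sigma>\<^sup>2 / 2"
  have eq: "(1 - c1 * b) ^ 3 * (pt (phi V) x - p * pt (xi V) x) -
      ?k * S * b * p * (1 - c1 * b) * (pu (phi V) x - p * pu (xi V) x - pt (tau V) x) +
      ?k * (2 * b * p * xi V x - 2 * c1 * S * b\<^sup>2 *
          (pS (phi V) x + p * (pu (phi V) x - pS (xi V) x) - p\<^sup>2 * pu (xi V) x) +
        S\<^sup>2 * (1 + c1 * b) * (pS (pS (phi V)) x +
          p * ((pu (pS (phi V)) x + pS (pu (phi V)) x) - pS (pS (xi V)) x) +
          p\<^sup>2 * (pu (pu (phi V)) x - (pu (pS (xi V)) x + pS (pu (xi V)) x)) - p ^ 3 * pu (pu (xi V)) x) +
        S * (1 + c1 * b) * b * p * (pu (phi V) x - 2 * pS (xi V) x - 3 * p * pu (xi V) x)) = 0"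
    if p: "p \<noteq> 0" and b: "1 - c1 * b \<noteq> 0" for p b
  proof -
    let ?r = "- ?k * S * b * p / (1 - c1 * b)\<^sup>2"
    let ?q = "b * p / S"
    \<comment> \<open>The factor \<open>(1 - c1 * b) ^ 3\<close> absorbs the denominator of
      \<open>?r\<close>. The literal zeros here and in \<open>q\<close> stand where the terms with
      partials of \<tau> have vanished.\<close>
    have r: "(1 - c1 * b) ^ 3 * (Ft + ?r * Fu - p * (Xt + ?r * Xu) - ?r * (Tt + ?r * 0)) =
      (1 - c1 * b) ^ 3 * (Ft - p * Xt) - ?k * S * b * p * (1 - c1 * b) * (Fu - p * Xu - Tt)"
      for Ft Fu Xt Xu Tt
    proof -
      have "e ^ 3 * (N / e\<^sup>2) = N * e" if "e \<noteq> 0" for e N :: real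
        using that by (simp add: power2_eq_square power3_eq_cube)
      from this[OF b] have "(1 - c1 * b) ^ 3 * ?r = - ?k * S * b * p * (1 - c1 * b)" .
      then show ?thesis by algebra
    qed
    have q: "S\<^sup>2 * (1 + c1 * b) * (A + p * B + p\<^sup>2 * C + ?q * F - p * D - p\<^sup>2 * E - p ^ 3 * G - ?q * H - 0 - 0) =
      S\<^sup>2 * (1 + c1 * b) * (A + p * (B - D) + p\<^sup>2 * (C - E) - p ^ 3 * G) + S * (1 + c1 * b) * b * p * (F - H)"
      for A B C D E F G H
    proof -
      have "S * ?q = b * p" using S by simp
      then show ?thesis by algebra
    qed
    have "(1 - c1 * b) ^ 3 * (pt (phi V) x + ?r * pu (phi V) x - p * (pt (xi V) x + ?r * pu (xi V) x) -
        ?r * (pt (tau V) x + ?r * 0)) +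
      ?k * (2 * b * p * xi V x - 2 * c1 * S * b\<^sup>2 *
        (pS (phi V) x + p * pu (phi V) x - p * (pS (xi V) x + p * pu (xi V) x) - ?r * 0) +
        S\<^sup>2 * (1 + c1 * b) * (pS (pS (phi V)) x + p * (pu (pS (phi V)) x + pS (pu (phi V)) x) +
          p\<^sup>2 * pu (pu (phi V)) x + ?q * pu (phi V) x - p * pS (pS (xi V)) x -
          p\<^sup>2 * (pu (pS (xi V)) x + pS (pu (xi V)) x) - p ^ 3 * pu (pu (xi V)) x -
          ?q * (2 * pS (xi V) x + 3 * p * pu (xi V) x) - 0 - 0)) = 0"
      using symmetry_condition[OF sym S p b, of t u 0]
      unfolding prolonged_SS_eq[OF symmetry_in_vector_fields S x]
        phi\<^sub>S_partials[OF symmetry_in_vector_fields S] phi\<^sub>t_partials[OF symmetry_in_vector_fields S]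
        x[symmetric] tau2
      by simp
    then show ?thesis unfolding r q by (simp add: algebra_simps power2_eq_square)
  qed
  show "pu (xi V) x = 0" "pt (xi V) x = 0" "pt (tau V) x = 0" "xi V x = S * pS (xi V) x"
    "pS (phi V) x = 0" "pt (phi V) x = 0" "pu (pu (phi V)) x = pu (pS (xi V)) x + pS (pu (xi V)) x"
    using determining_equations[OF S k c1 eq] by blast+
qed

text \<open>The equations for \<xi> say that all partials of \<open>xi V x / fst x\<close> vanish,
  so this quotient is constant on the convex set \<open>M\<close>.\<close>

lemma symmetry_xi:
  assumes "S > 0"
  shows "xi V (S, t, u) = xi V (1, 0, 0) * S"
proof -
  have "xi V (S, t, u) / fst (S, t, u) = xi V (1, 0, 0) / fst (1::real, 0::real, 0::real)"
  proof (rule eq_if_derivative_0_on_M)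
    fix z assume z: "z \<in> M"
    obtain S' t' u' where zz: "z = (S', t', u')" by (cases z)
    then have S': "S' > 0" using z by simp
    have X: "(xi V has_derivative (\<lambda>(a, b, c). a * pS (xi V) z)) (at z)"
      using has_derivative_partials[OF twice_differentiableD(1)[OF symmetry_coeffs(1) z]]
        symmetry_determining_equations(1,2)[OF S' zz] by simp
    have D: "((\<lambda>x. xi V x / fst x) has_derivative
      (\<lambda>h. ((case h of (a, b, c) \<Rightarrow> a * pS (xi V) z) * fst z - xi V z * fst h) / (fst z * fst z))) (at z)"
      by (rule has_derivative_divide'[OF X]) (use S' zz in \<open>auto intro!: derivative_eq_intros\<close>)
    have xi: "xi V z = S' * pS (xi V) z"
      by (rule symmetry_determining_equations(4)[OF S' zz])
    show "\<exists>D. ((\<lambda>x. xi V x / fst x) has_derivative D) (at z) \<and> D ((1, 0, 0) - (S, t, u)) = 0"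
      by (intro exI conjI, rule D) (simp add: xi, simp add: zz)
  qed (use assms in auto)
  then show ?thesis using assms by (simp add: field_simps)
qed

lemma symmetry_tau_constant:
  assumes "S > 0"
  shows "tau V (S, t, u) = tau V (1, 0, 0)"
proof (rule eq_if_derivative_0_on_M)
  fix z assume z: "z \<in> M"
  obtain S' t' u' where zz: "z = (S', t', u')" by (cases z)
  then have S': "S' > 0" using z by simp
  show "\<exists>D. (tau V has_derivative D) (at z) \<and> D ((1, 0, 0) - (S, t, u)) = 0"
    using has_derivative_partials[OF twice_differentiableD(1)[OF symmetry_coeffs(2) z]]
      symmetry_determining_equations(3)[OF S' zz] symmetry_tau[OF z] by auto
qed (use assms in auto)

text \<open>As \<xi> is linear in \<open>S\<close>, its mixed partials vanish, and the last
  determining equation becomes \<open>pu (pu (phi V)) x = 0\<close>. Since \<phi> depends on neither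
  \<open>S\<close> nor \<open>t\<close>, integration along the line \<open>(1, 0, u)\<close>
  suffices.\<close>

lemma symmetry_phi:
  obtains b where "\<And>S t u. S > 0 \<Longrightarrow> phi V (S, t, u) = b * u + phi V (1, 0, 0)"
proof (rule that)
  have "xi V (S, t, u) = xi V (1, 0, 0) * S + 0 * t + 0 * u + 0" if "S > 0" for S t u
    using symmetry_xi[OF that, of t u] by simp
  note xi_affine = partials_affine[of "xi V", OF this]
  have xi1: "pS (xi V) z = xi V (1, 0, 0)" "pu (xi V) z = 0" if "z \<in> M" for z
    using xi_affine(1,3)[OF _ that] by blast+
  have xi2: "pu (pS (xi V)) z = 0" "pS (pu (xi V)) z = 0" if "z \<in> M" for z
    using partials_constant(3)[OF xi1(1) that] partials_constant(1)[OF xi1(2) that] by simp_all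
  let ?b = "pu (phi V) (1, 0, 0)"
  have seg: "\<exists>w. z = (1, 0, w)" if "z \<in> closed_segment (1::real, 0::real, u::real) (1, 0, 0)" for z u
    using that by (auto simp: in_segment)
  \<comment> \<open>Only the \<open>u\<close>-derivative of \<open>pu (phi V)\<close> is controlled
    here, so the segment runs in the direction of \<open>u\<close>.\<close>
  have b: "pu (phi V) (1, 0, u) = ?b" for u
  proof (rule eq_if_derivative_0_on_segment[of "(1, 0, u)" "(1, 0, 0)" "pu (phi V)"])
    fix z :: point assume "z \<in> closed_segment (1, 0, u) (1, 0, 0)"
    then obtain w where w: "z = (1, 0, w)" using seg by blast
    then have z: "z \<in> M" by simp
    show "\<exists>D. (pu (phi V) has_derivative D) (at z) \<and> D ((1, 0, 0) - (1, 0, u)) = 0"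
      using has_derivative_partials[OF twice_differentiableD(4)[OF symmetry_coeffs(3) z]]
        symmetry_determining_equations(7)[OF _ w] xi2[OF z] by auto
  qed
  fix S t u :: real assume S: "S > 0"
  have "phi V (S, t, u) = phi V (1, 0, u)"
  proof (rule eq_if_derivative_0_on_M)
    fix z assume z: "z \<in> M"
    obtain S' t' u' where zz: "z = (S', t', u')" by (cases z)
    then have S': "S' > 0" using z by simp
    show "\<exists>D. (phi V has_derivative D) (at z) \<and> D ((1, 0, u) - (S, t, u)) = 0"
      using has_derivative_partials[OF twice_differentiableD(1)[OF symmetry_coeffs(3) z]]
        symmetry_determining_equations(5,6)[OF S' zz] by auto
  qed (use S in auto)
  also have "phi V (1, 0, u) = ?b * u + phi V (1, 0, 0)"
  proof -
    \<comment> \<open>Subtracting the linear part leaves a function with vanishing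
      \<open>u\<close>-derivative on the line.\<close>
    have "phi V (1, 0, u) - ?b * snd (snd (1::real, 0::real, u)) =
      phi V (1, 0, 0) - ?b * snd (snd (1::real, 0::real, 0::real))"
    proof (rule eq_if_derivative_0_on_segment[of "(1, 0, u)" "(1, 0, 0)"
          "\<lambda>x. phi V x - ?b * snd (snd x)"])
      fix z :: point assume "z \<in> closed_segment (1, 0, u) (1, 0, 0)"
      then obtain w where w: "z = (1, 0, w)" using seg by blast
      then have z: "z \<in> M" by simp
      have "((\<lambda>x. ?b * snd (snd x)) has_derivative (\<lambda>x. ?b * snd (snd x))) (at z)"
        by (auto intro!: derivative_eq_intros)
      note D = has_derivative_diff[OF
          has_derivative_partials[OF twice_differentiableD(1)[OF symmetry_coeffs(3) z]] this]
      show "\<exists>D. ((\<lambda>x. phi V x - ?b * snd (snd x)) has_derivative D) (at z) \<and>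
          D ((1, 0, 0) - (1, 0, u)) = 0"
        by (intro exI conjI, rule D) (simp add: w b[of w])
    qed
    then show ?thesis by simp
  qed
  finally show "phi V (S, t, u) = ?b * u + phi V (1, 0, 0)" .
qed

lemma symmetry_is_affine_field: "\<exists>a b c d. V = affine_field a b c d"
proof -
  obtain b where b: "phi V (S, t, u) = b * u + phi V (1, 0, 0)" if "S > 0" for S t u
    using symmetry_phi by blast
  have "V x = affine_field (xi V (1, 0, 0)) b (phi V (1, 0, 0)) (tau V (1, 0, 0)) x" for x
  proof (cases "x \<in> M")
    case True
    then obtain S t u where x: "x = (S, t, u)" "S > 0" by (cases x) auto
    have "V x = (xi V x, tau V x, phi V x)" by (simp add: xi_def tau_def phi_def)
    also have "\<dots> = affine_field (xi V (1, 0, 0)) b (phi V (1, 0, 0)) (tau V (1, 0, 0)) x"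
      unfolding x(1) affine_field_on_M[OF x(2)]
        symmetry_xi[OF x(2), of t u] symmetry_tau_constant[OF x(2), of t u] b[OF x(2), of t u] ..
    finally show ?thesis .
  next
    case False
    then show ?thesis
      using symmetry_in_vector_fields
      by (simp add: vector_fields_def affine_field_def on_M_def del: split_paired_All)
  qed
  then show ?thesis by blast
qed

end

section \<open>The Lie algebra\<close>

lemma symmetry_algebra_eq:
  assumes "\<sigma> > 0" "c1 \<noteq> 0"
  shows "symmetry_algebra \<sigma> c1 = {affine_field a b c d | a b c d. True}"
  using symmetry_is_affine_field[OF assms] affine_field_symmetry
  by (auto simp: symmetry_algebra_def)

section \<open>Coordinates for the affine fields\<close>

lemma affine_field_eq_iff:
  "affine_field a b c d = affine_field a' b' c' d' \<longleftrightarrow> a = a' \<and> b = b' \<and> c = c' \<and> d = d'"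
proof
  assume "affine_field a b c d = affine_field a' b' c' d'"
  then have "affine_field a b c d (1, 0, u) = affine_field a' b' c' d' (1, 0, u)" for u by simp
  from this[of 0] this[of 1] show "a = a' \<and> b = b' \<and> c = c' \<and> d = d'"
    by (simp add: affine_field_on_M)
qed simp

lemma affine_field_add:
  "affine_field a b c d + affine_field a' b' c' d' = affine_field (a + a') (b + b') (c + c') (d + d')"
  by (auto simp: affine_field_def on_M_def fun_eq_iff algebra_simps)

lemma affine_field_scaleR:
  "k *\<^sub>R affine_field a b c d = affine_field (k * a) (k * b) (k * c) (k * d)"
  by (auto simp: affine_field_def on_M_def fun_eq_iff scaleR_fun_def algebra_simps)

lemma zero_eq_affine_field: "0 = affine_field 0 0 0 0"
  by (auto simp: affine_field_def on_M_def fun_eq_iff zero_prod_def)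

lemma affine_field_uminus: "- affine_field a b c d = affine_field (- a) (- b) (- c) (- d)"
  using affine_field_scaleR[of "-1"] by simp

lemma affine_field_diff:
  "affine_field a b c d - affine_field a' b' c' d' = affine_field (a - a') (b - b') (c - c') (d - d')"
  unfolding diff_conv_add_uminus affine_field_uminus affine_field_add ..

lemma V_eq_affine_field:
  "V1 = affine_field 1 0 0 0" "V2 = affine_field 0 1 0 0"
  "V3 = affine_field 0 0 1 0" "V4 = affine_field 0 0 0 1"
  by (simp_all add: V1_def V2_def V3_def V4_def affine_field_def)

lemma affine_field_has_derivative:
  assumes "x \<in> M"
  shows "(affine_field a b c d has_derivative (\<lambda>h. (a * fst h, 0, b * snd (snd h)))) (at x)"
proof -
  have "((\<lambda>x::point. (a * fst x, d, b * snd (snd x) + c)) has_derivative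
      (\<lambda>h. (a * fst h, 0, b * snd (snd h)))) (at x)"
    by (auto intro!: derivative_eq_intros)
  moreover have "affine_field a b c d y = (a * fst y, d, b * snd (snd y) + c)" if "y \<in> M" for y
    using that by (cases y) (simp add: affine_field_on_M)
  ultimately show ?thesis
    using has_derivative_cong_open[OF open_M assms, of "affine_field a b c d"] by simp
qed

text \<open>The linear parts are diagonal and commute. What remains is the action of the scaling of
  \<open>u\<close> on translations of \<open>u\<close>, a multiple of \<open>V3\<close>.\<close>

lemma lie_bracket_affine_field:
  "lie_bracket (affine_field a b c d) (affine_field a' b' c' d') =
    affine_field 0 0 (b' * c - b * c') 0"
proof
  fix x
  show "lie_bracket (affine_field a b c d) (affine_field a' b' c' d') x =
    affine_field 0 0 (b' * c - b * c') 0 x"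
  proof (cases "x \<in> M")
    case True
    then obtain S t u where x: "x = (S, t, u)" "S > 0" by (cases x) auto
    show ?thesis
      unfolding lie_bracket_def on_M_def frechet_derivative_at_eq[OF affine_field_has_derivative[OF True]]
      using x by (simp add: affine_field_on_M algebra_simps)
  qed (simp add: lie_bracket_def affine_field_def on_M_def)
qed

text \<open>Subsets of \<open>L4\<close> are described by predicates on coordinates, which turns
  claims on spans, ideals and sums into real arithmetic.\<close>

definition affine_fields :: "(real \<Rightarrow> real \<Rightarrow> real \<Rightarrow> real \<Rightarrow> bool) \<Rightarrow> vfield set"
  where "affine_fields P = {affine_field a b c d | a b c d. P a b c d}"

lemma affine_field_in_affine_fields [simp]: "affine_field a b c d \<in> affine_fields P \<longleftrightarrow> P a b c d"
  by (auto simp: affine_fields_def affine_field_eq_iff)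

lemma affine_fieldsE:
  assumes "x \<in> affine_fields P"
  obtains a b c d where "x = affine_field a b c d" "P a b c d"
  using assms by (auto simp: affine_fields_def)

lemma affine_fields_eqI:
  assumes "X \<subseteq> affine_fields (\<lambda>_ _ _ _. True)" "\<And>a b c d. affine_field a b c d \<in> X \<longleftrightarrow> P a b c d"
  shows "X = affine_fields P"
proof (rule set_eqI)
  fix x
  show "x \<in> X \<longleftrightarrow> x \<in> affine_fields P"
  proof (cases "\<exists>a b c d. x = affine_field a b c d")
    case True
    then show ?thesis using assms(2) by auto
  next
    case False
    then show ?thesis using assms(1) by (blast elim: affine_fieldsE)
  qed
qed

lemma subspace_affine_fields:
  assumes "P 0 0 0 0"
    "\<And>a b c d a' b' c' d'. P a b c d \<Longrightarrow> P a' b' c' d' \<Longrightarrow> P (a + a') (b + b') (c + c') (d + d')"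
    "\<And>k a b c d. P a b c d \<Longrightarrow> P (k * a) (k * b) (k * c) (k * d)"
  shows "subspace (affine_fields P)"
  unfolding subspace_def using assms
  by (auto elim!: affine_fieldsE simp: zero_eq_affine_field affine_field_add affine_field_scaleR)

text \<open>Removes one generator at a time, until membership in a span becomes a system of linear
  equations in the coordinates.\<close>

lemma affine_field_in_span_insert:
  "affine_field a b c d \<in> span (insert (affine_field a' b' c' d') X) \<longleftrightarrow>
    (\<exists>k. affine_field (a - k * a') (b - k * b') (c - k * c') (d - k * d') \<in> span X)"
  by (simp add: real_vector.span_breakdown_eq affine_field_scaleR affine_field_diff)

lemma affine_field_eq_0_iff: "affine_field a b c d = 0 \<longleftrightarrow> a = 0 \<and> b = 0 \<and> c = 0 \<and> d = 0"
  by (simp add: zero_eq_affine_field affine_field_eq_iff)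

lemma span_affine_fields:
  assumes "X \<subseteq> affine_fields (\<lambda>_ _ _ _. True)" "\<And>a b c d. affine_field a b c d \<in> span X \<longleftrightarrow> P a b c d"
  shows "span X = affine_fields P"
  by (intro affine_fields_eqI span_minimal assms subspace_affine_fields) simp_all

lemma span_V1: "span {V1} = affine_fields (\<lambda>a b c d. b = 0 \<and> c = 0 \<and> d = 0)"
  unfolding V_eq_affine_field
  by (rule span_affine_fields) (auto simp: affine_field_in_span_insert affine_field_eq_0_iff)

lemma span_V4: "span {V4} = affine_fields (\<lambda>a b c d. a = 0 \<and> b = 0 \<and> c = 0)"
  unfolding V_eq_affine_field
  by (rule span_affine_fields) (auto simp: affine_field_in_span_insert affine_field_eq_0_iff)

lemma L2_eq: "L2 = affine_fields (\<lambda>a b c d. a = 0 \<and> d = 0)"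
  unfolding L2_def V_eq_affine_field
  by (rule span_affine_fields) (auto simp: affine_field_in_span_insert affine_field_eq_0_iff)

lemma L4_eq: "L4 = affine_fields (\<lambda>_ _ _ _. True)"
  unfolding L4_def V_eq_affine_field
  by (rule span_affine_fields) (auto simp: affine_field_in_span_insert affine_field_eq_0_iff)

lemma L2_plus_V1_eq: "L2 + span {V1} = affine_fields (\<lambda>a b c d. d = 0)"
proof (rule affine_fields_eqI)
  show "L2 + span {V1} \<subseteq> affine_fields (\<lambda>_ _ _ _. True)"
    unfolding L2_eq span_V1 by (auto simp: set_plus_def affine_field_add elim!: affine_fieldsE)
  show "affine_field a b c d \<in> L2 + span {V1} \<longleftrightarrow> d = 0" for a b c d
  proof
    assume "affine_field a b c d \<in> L2 + span {V1}"
    then show "d = 0" unfolding L2_eq span_V1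
      by (auto simp: set_plus_def affine_field_add affine_field_eq_iff elim!: affine_fieldsE)
  next
    assume "d = 0"
    then have "affine_field a b c d = affine_field 0 b c 0 + affine_field a 0 0 0"
      by (simp add: affine_field_add)
    then show "affine_field a b c d \<in> L2 + span {V1}"
      unfolding L2_eq span_V1 by (auto intro: set_plus_intro)
  qed
qed

lemma lie_algebra_affine_fields:
  assumes "subspace (affine_fields P)"
    "\<And>a b c d a' b' c' d'. P a b c d \<Longrightarrow> P a' b' c' d' \<Longrightarrow> P 0 0 (b' * c - b * c') 0"
  shows "lie_algebra (affine_fields P)"
  using assms affine_field_in_vector_fields
  by (auto simp: lie_algebra_def lie_bracket_affine_field elim!: affine_fieldsE)

text \<open>Brackets have only a \<open>V3\<close> component, so closure is a condition on that
  single coordinate.\<close>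

lemma lie_ideal_affine_fields:
  assumes "subspace (affine_fields P)" "\<And>a b c d. P a b c d \<Longrightarrow> Q a b c d"
    "\<And>a b c d a' b' c' d'. Q a b c d \<Longrightarrow> P a' b' c' d' \<Longrightarrow> P 0 0 (b' * c - b * c') 0"
  shows "lie_ideal (affine_fields P) (affine_fields Q)"
  using assms by (auto simp: lie_ideal_def lie_bracket_affine_field elim!: affine_fieldsE)

lemma subspaces:
  "subspace (span {V1})" "subspace (span {V4})" "subspace L2" "subspace L4" "subspace (L2 + span {V1})"
  by (auto simp: L2_plus_V1_eq intro: subspace_affine_fields) (simp_all add: L2_def L4_def)

lemma lie_algebras:
  "lie_algebra (span {V1})" "lie_algebra (span {V4})" "lie_algebra L2" "lie_algebra L4"
  "lie_algebra (L2 + span {V1})"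
  unfolding L2_plus_V1_eq unfolding span_V1 span_V4 L2_eq L4_eq
  by (auto intro!: lie_algebra_affine_fields subspace_affine_fields)

lemma lie_ideals:
  "lie_ideal L2 L4" "lie_ideal (span {V4}) L4" "lie_ideal (L2 + span {V1}) L4"
  "lie_ideal L2 (L2 + span {V1})"
  unfolding L2_plus_V1_eq unfolding span_V1 span_V4 L2_eq L4_eq
  by (auto intro!: lie_ideal_affine_fields subspace_affine_fields)

section \<open>Direct sum decompositions\<close>

text \<open>Lists of length two correspond bijectively to pairs, where injectivity and surjectivity
  are easier to check.\<close>

lemma direct_sum_two:
  "direct_sum L [A, B] \<longleftrightarrow> subspace A \<and> subspace B \<and> bij_betw (\<lambda>(x, y). x + y) (A \<times> B) L"
proof -
  have "bij_betw (\<lambda>(x, y). [x, y]) (A \<times> B) (listset [A, B])"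
    by (auto simp: bij_betw_def inj_on_def set_Cons_def)
  from bij_betw_comp_iff[OF this, of sum_list L] show ?thesis
    by (simp add: direct_sum_def comp_def case_prod_unfold conj_assoc)
qed

lemma direct_sum_three:
  "direct_sum L [A, B, C] \<longleftrightarrow> subspace A \<and> subspace B \<and> subspace C \<and>
    bij_betw (\<lambda>(x, y, z). x + (y + z)) (A \<times> B \<times> C) L"
proof -
  have "bij_betw (\<lambda>(x, y, z). [x, y, z]) (A \<times> B \<times> C) (listset [A, B, C])"
    by (force simp: bij_betw_def inj_on_def set_Cons_def)
  from bij_betw_comp_iff[OF this, of sum_list L] show ?thesis
    by (simp add: direct_sum_def comp_def case_prod_unfold conj_assoc)
qed

lemma direct_sum_L4_three: "direct_sum L4 [L2, span {V1}, span {V4}]"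
proof -
  have "bij_betw (\<lambda>(x, y, z). x + (y + z)) (L2 \<times> span {V1} \<times> span {V4}) L4"
    unfolding bij_betw_def
  proof
    show "inj_on (\<lambda>(x, y, z). x + (y + z)) (L2 \<times> span {V1} \<times> span {V4})"
      unfolding L2_eq span_V1 span_V4
      by (auto simp: inj_on_def affine_field_add affine_field_eq_iff elim!: affine_fieldsE)
    have "affine_field a b c d \<in> (\<lambda>(x, y, z). x + (y + z)) ` (L2 \<times> span {V1} \<times> span {V4})" for a b c d
      unfolding L2_eq span_V1 span_V4
      by (rule image_eqI[of _ _ "(affine_field 0 b c 0, affine_field a 0 0 0, affine_field 0 0 0 d)"])
        (simp_all add: affine_field_add)
    then show "(\<lambda>(x, y, z). x + (y + z)) ` (L2 \<times> span {V1} \<times> span {V4}) = L4"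
      unfolding L2_eq L4_eq span_V1 span_V4 by (auto simp: affine_field_add elim!: affine_fieldsE)
  qed
  with subspaces show ?thesis by (simp add: direct_sum_three)
qed

lemma direct_sum_L2_V1: "direct_sum (L2 + span {V1}) [L2, span {V1}]"
proof -
  have "inj_on (\<lambda>(x, y). x + y) (L2 \<times> span {V1})"
    unfolding L2_eq span_V1
    by (auto simp: inj_on_def affine_field_add affine_field_eq_iff elim!: affine_fieldsE)
  moreover have "(\<lambda>(x, y). x + y) ` (L2 \<times> span {V1}) = L2 + span {V1}"
    by (simp add: set_plus_image)
  ultimately show ?thesis
    using subspaces by (simp add: direct_sum_two bij_betw_def)
qed

text \<open>Both summands are ideals of \<open>L4\<close>, so this splitting witnesses
  decomposability.\<close>

lemma direct_sum_L4_two: "direct_sum L4 [L2 + span {V1}, span {V4}]"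
proof -
  let ?f = "\<lambda>(x, y). x + y :: vfield" and ?A = "affine_fields (\<lambda>a b c d. d = 0) \<times> span {V4}"
  have "inj_on ?f ?A"
    unfolding span_V4
    by (auto simp: inj_on_def affine_field_add affine_field_eq_iff elim!: affine_fieldsE)
  moreover have "affine_field a b c d \<in> ?f ` ?A" for a b c d
    unfolding span_V4
    by (rule image_eqI[of _ _ "(affine_field a b c 0, affine_field 0 0 0 d)"])
      (simp_all add: affine_field_add)
  then have "?f ` ?A = L4"
    unfolding L4_eq span_V4 by (auto simp: affine_field_add elim!: affine_fieldsE)
  ultimately show ?thesis
    using subspaces by (simp add: direct_sum_two bij_betw_def L2_plus_V1_eq)
qed

section \<open>Independence, dimensions and the final result\<close>

lemma independent_V: "independent {V1, V2, V3, V4}"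
  unfolding V_eq_affine_field
  by (simp add: real_vector.independent_insert affine_field_in_span_insert affine_field_eq_0_iff
      affine_field_eq_iff)

lemma distinct_V: "distinct [V1, V2, V3, V4]"
  by (simp add: V_eq_affine_field affine_field_eq_iff)

lemma dim_L4: "dim L4 = 4"
  using distinct_V by (simp add: L4_def dim_eq_card_independent[OF independent_V])

lemma dim_L2: "dim L2 = 2"
proof -
  have "independent {V2, V3}" by (rule independent_mono[OF independent_V]) auto
  from dim_eq_card_independent[OF this] show ?thesis using distinct_V by (simp add: L2_def)
qed

text \<open>The semi-direct sum of three summands is stated in both readings: as one sum of three
  subalgebras, and as two successive sums of two.\<close>

theorem theorem4p1:
  fixes \<sigma> c1 :: real
  assumes "\<sigma> > 0" and "c1 \<noteq> 0"
  shows "symmetry_algebra \<sigma> c1 = L4 \<and> lie_algebra L4 \<and> dim L4 = 4 \<and>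
    lie_bracket V2 V3 = - V3 \<and> - V3 \<noteq> 0 \<and> lie_bracket V3 V2 = V3 \<and>
    (\<forall>V\<in>{V1, V2, V3, V4}. \<forall>W\<in>{V1, V2, V3, V4}.
       (V, W) \<noteq> (V2, V3) \<and> (V, W) \<noteq> (V3, V2) \<longrightarrow> lie_bracket V W = 0) \<and>
    lie_subalgebra L2 L4 \<and> dim L2 = 2 \<and>
    decomposable L4 \<and>
    semidirect_sum L4 [L2, span {V1}, span {V4}] \<and>
    semidirect_sum (L2 + span {V1}) [L2, span {V1}] \<and>
    semidirect_sum L4 [L2 + span {V1}, span {V4}]"
proof (intro conjI)
  show "symmetry_algebra \<sigma> c1 = L4"
    unfolding symmetry_algebra_eq[OF assms] L4_eq affine_fields_def ..
  show "lie_bracket V2 V3 = - V3" "- V3 \<noteq> 0" "lie_bracket V3 V2 = V3"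
    by (simp_all add: V_eq_affine_field lie_bracket_affine_field affine_field_uminus
        zero_eq_affine_field affine_field_eq_iff)
  show "\<forall>V\<in>{V1, V2, V3, V4}. \<forall>W\<in>{V1, V2, V3, V4}.
       (V, W) \<noteq> (V2, V3) \<and> (V, W) \<noteq> (V3, V2) \<longrightarrow> lie_bracket V W = 0"
    by (simp add: V_eq_affine_field lie_bracket_affine_field zero_eq_affine_field affine_field_eq_iff)
  have sub: "lie_subalgebra L2 L4" "lie_subalgebra (span {V1}) L4" "lie_subalgebra (span {V4}) L4"
    "lie_subalgebra (L2 + span {V1}) L4" "lie_subalgebra L2 (L2 + span {V1})"
    "lie_subalgebra (span {V1}) (L2 + span {V1})"
    using lie_algebras unfolding lie_subalgebra_def L2_plus_V1_eq
    unfolding L2_eq L4_eq span_V1 span_V4 by (auto elim!: affine_fieldsE)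
  then show "lie_subalgebra L2 L4" by simp
  \<comment> \<open>\<open>V2\<close> and \<open>V4\<close> show that the two ideals
    \<open>L2 + span {V1}\<close> and \<open>span {V4}\<close> are non-zero.\<close>
  have "V \<noteq> 0" if "V \<in> {V2, V4}" for V
    using that by (auto simp: V_eq_affine_field zero_eq_affine_field affine_field_eq_iff)
  moreover have "V2 \<in> L2 + span {V1}" "V4 \<in> span {V4}"
    unfolding L2_plus_V1_eq span_V4 by (simp_all add: V_eq_affine_field)
  ultimately show "decomposable L4"
    unfolding decomposable_def using lie_ideals direct_sum_L4_two by blast
  show "semidirect_sum L4 [L2, span {V1}, span {V4}]"
    "semidirect_sum (L2 + span {V1}) [L2, span {V1}]"
    "semidirect_sum L4 [L2 + span {V1}, span {V4}]"
    using sub lie_algebras lie_ideals direct_sum_L4_three direct_sum_L4_two direct_sum_L2_V1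
    by (simp_all add: semidirect_sum_def)
qed (fact lie_algebras dim_L4 dim_L2)+

end
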